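(* Let $k\ge 0$ be an integer. The exponential generating functions $A_k(x)=\sum_{n\ge 0}a_{n,k}\frac{x^n}{n!}$ and $R_k(x)=\sum_{n\ge 0} r_{n,k}\frac{x^n}{n!}$ satisfy the differential equation $$A_k'(x)=2\,\frac{A_k(x)}{1-x}+R_k'(x),$$ with the initial condition $A_k(0)=0$. Here $a_{n,k}$ is the total number of balanced vertices of rank $k$ in all decreasing binary trees on $[n]$, and $r_{n,k}$ is the number of decreasing binary trees on $[n]$ whose root is balanced of rank $k$.
   Context: A decreasing binary tree on vertex set $[n]=\{1,2,\dots,n\}$ is a rooted binary plane tree whose vertices are bijectively labeled by $[n]$, in which every vertex has a smaller label than its parent, every vertex has at most two children, and every child is designated either a left child or a right child of its parent (a vertex has at most one left child and at most one right child), even if it is the only child of its parent. A leaf is a vertex with no children. A vertex $v$ of a rooted tree is called balanced if all descending paths from $v$ to a leaf have the same length (number of edges); that common length is the rank of $v$. In particular leaves are balanced, of rank $0$. For $n=0$ there are no vertices and no root, so $a_{0,k}=r_{0,k}=0$. The generating functions are formal power series. *)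

theory Defs
  imports "HOL-Library.Tree" "HOL-Computational_Algebra.Formal_Power_Series"
begin

text \<open>A binary plane tree is a value of the library type \<^typ>\<open>nat tree\<close>; note that the constructor
  \<^const>\<open>Leaf\<close> is the empty tree, so a childless vertex \<open>v\<close> is \<open>Node Leaf v Leaf\<close>.
  Since labels are distinct in the trees considered, vertices are identified with their labels.\<close>

definition child_of :: "'a tree \<Rightarrow> 'a \<Rightarrow> 'a \<Rightarrow> bool" where
  "child_of t u v \<longleftrightarrow>
     (\<exists>l r l' r'. Node l u r \<in> subtrees t \<and> (l = Node l' v r' \<or> r = Node l' v r'))"

definition leaf_vertex :: "'a tree \<Rightarrow> 'a \<Rightarrow> bool" where
  "leaf_vertex t v \<longleftrightarrow> v \<in> set_tree t \<and> (\<nexists>w. child_of t v w)"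

definition decreasing_binary_trees :: "nat \<Rightarrow> nat tree set" where
  "decreasing_binary_trees n =
     {t. set_tree t = {1..n} \<and> distinct (inorder t) \<and> (\<forall>u v. child_of t u v \<longrightarrow> v < u)}"

definition descending_leaf_path :: "'a tree \<Rightarrow> 'a \<Rightarrow> 'a list \<Rightarrow> bool" where
  "descending_leaf_path t v p \<longleftrightarrow>
     p \<noteq> [] \<and> hd p = v \<and> successively (child_of t) p \<and> leaf_vertex t (last p)"

text \<open>Paths are lists of vertices, so the number of edges is one less than the list length.\<close>

definition leaf_path_lengths :: "'a tree \<Rightarrow> 'a \<Rightarrow> nat set" where
  "leaf_path_lengths t v = {d. \<exists>p. descending_leaf_path t v p \<and> length p = Suc d}"

definition balanced :: "'a tree \<Rightarrow> 'a \<Rightarrow> bool" where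
  "balanced t v \<longleftrightarrow> v \<in> set_tree t \<and>
     (\<forall>d \<in> leaf_path_lengths t v. \<forall>e \<in> leaf_path_lengths t v. d = e)"

text \<open>The rank is meaningful only for balanced vertices.\<close>

definition rank :: "'a tree \<Rightarrow> 'a \<Rightarrow> nat" where
  "rank t v = the_elem (leaf_path_lengths t v)"

definition balanced_count :: "nat \<Rightarrow> nat \<Rightarrow> nat" where
  "balanced_count n k = (\<Sum>t \<in> decreasing_binary_trees n. card {v \<in> set_tree t. balanced t v \<and> rank t v = k})"

definition root_balanced_count :: "nat \<Rightarrow> nat \<Rightarrow> nat" where
  "root_balanced_count n k = card {t \<in> decreasing_binary_trees n.
                   t \<noteq> Leaf \<and> balanced t (value t) \<and> rank t (value t) = k}"

definition A_egf :: "nat \<Rightarrow> rat fps" where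
  "A_egf k = Abs_fps (\<lambda>n. of_nat (balanced_count n k) / fact n)"

definition R_egf :: "nat \<Rightarrow> rat fps" where
  "R_egf k = Abs_fps (\<lambda>n. of_nat (root_balanced_count n k) / fact n)"

text \<open>The index set of the sum defining \<^const>\<open>balanced_count\<close> is finite, so \<^const>\<open>sum\<close> and \<^const>\<open>card\<close>
  have their usual meaning.\<close>

lemma finite_trees_of_size: "finite {t :: 'a tree. set_tree t \<subseteq> S \<and> size t \<le> n}"
  if "finite S"
proof (induction n)
  case 0
  have "{t :: 'a tree. set_tree t \<subseteq> S \<and> size t \<le> 0} \<subseteq> {Leaf}" by auto
  then show ?case by (rule finite_subset) simp
next
  case (Suc n)
  let ?T = "{t :: 'a tree. set_tree t \<subseteq> S \<and> size t \<le> n}"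
  have "{t :: 'a tree. set_tree t \<subseteq> S \<and> size t \<le> Suc n}
          \<subseteq> insert Leaf ((\<lambda>(l, x, r). Node l x r) ` (?T \<times> S \<times> ?T))"
  proof
    fix t :: "'a tree"
    assume "t \<in> {t. set_tree t \<subseteq> S \<and> size t \<le> Suc n}"
    then show "t \<in> insert Leaf ((\<lambda>(l, x, r). Node l x r) ` (?T \<times> S \<times> ?T))"
      by (cases t) (auto simp: image_iff)
  qed
  then show ?case by (rule finite_subset) (use Suc that in simp)
qed

lemma finite_decreasing_binary_trees: "finite (decreasing_binary_trees n)"
proof (rule finite_subset)
  show "decreasing_binary_trees n \<subseteq> {t. set_tree t \<subseteq> {1..n} \<and> size t \<le> n}"
  proof
    fix t assume "t \<in> decreasing_binary_trees n"
    then have t: "set_tree t = {1..n}" "distinct (inorder t)"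
      by (auto simp: decreasing_binary_trees_def)
    have "size t = card (set_tree t)"
      using t(2) distinct_card by fastforce
    with t show "t \<in> {t. set_tree t \<subseteq> {1..n} \<and> size t \<le> n}" by simp
  qed
qed (simp add: finite_trees_of_size)

end

theory Submission
  imports Defs "HOL-Library.Infinite_Set"
begin

text \<open>
  The differential equation is the generating-function form of the recurrence
  \<open>a\<^sub>n\<^sub>+\<^sub>1 = 2 (\<Sum>i\<le>n. (n choose i) a\<^sub>i (n - i)!) + r\<^sub>n\<^sub>+\<^sub>1\<close> (\<open>balanced_count_Suc\<close>), where \<open>k\<close> is fixed:
  dividing by \<open>n!\<close> turns the sum into the partial sum \<open>\<Sum>i\<le>n. a\<^sub>i / i!\<close>, which is the coefficient
  of \<open>x\<^sup>n\<close> in \<open>A / (1 - x)\<close>.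

  The recurrence comes from removing the root. In a decreasing tree the root carries the largest
  label \<open>n + 1\<close>, so such a tree is a choice of the label set \<open>X \<subseteq> {1..n}\<close> of the left subtree together
  with arbitrary decreasing trees on \<open>X\<close> and on the complement (\<open>trees_on_insert\<close>). A balanced vertex
  of rank \<open>k\<close> is either the root, which \<open>r\<^sub>n\<^sub>+\<^sub>1\<close> counts, or lies in one of the two subtrees; swapping
  \<open>X\<close> with its complement shows that both subtrees contribute equally, whence the factor 2. If the
  chosen vertex is in the subtree on \<open>i\<close> labels, then the other subtree is free, and there are
  \<open>(n - i)!\<close> decreasing trees on the remaining labels (\<open>card_trees_on\<close>).

  Two points need care. Balance and rank are defined by paths in the whole tree, and must be seen to
  depend only on the subtree below the vertex (\<open>balanced_rank_iff\<close>). And the subtrees have label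
  sets other than an initial segment of the positive integers, so the counts have to be transported along
  order-preserving relabellings (\<open>sum_trees_on_cong_card\<close>).
\<close>

section \<open>Balanced vertices via subtrees\<close>

text \<open>The set of edge distances from the root to the leaf vertices. The case distinction is needed because
  the constructor \<^const>\<open>Leaf\<close> is the empty tree: a vertex without children is
  at distance \<open>0\<close> from itself.\<close>

fun leaf_depths :: "'a tree \<Rightarrow> nat set" where
  "leaf_depths Leaf = {}"
| leaf_depths_Node: "leaf_depths (Node l a r) =
     (if l = Leaf \<and> r = Leaf then {0} else Suc ` (leaf_depths l \<union> leaf_depths r))"

declare leaf_depths_Node [simp del]

lemma leaf_depths_nonempty: "t \<noteq> Leaf \<Longrightarrow> leaf_depths t \<noteq> {}"
  by (induction t) (auto simp: leaf_depths_Node)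

lemma subtrees_trans: "s \<in> subtrees t \<Longrightarrow> u \<in> subtrees s \<Longrightarrow> u \<in> subtrees t"
  by (induction t) auto

lemma subtrees_refl: "t \<in> subtrees t"
  by (cases t) auto

lemma ex_subtree_iff: "(\<exists>l r. Node l v r \<in> subtrees t) \<longleftrightarrow> v \<in> set_tree t"
  by (induction t) (auto dest: in_set_tree_if)

lemma subtree_label_in: "Node l v r \<in> subtrees t \<Longrightarrow> v \<in> set_tree t"
  using ex_subtree_iff by metis

lemma in_subtrees_Node:
  "Node l v r \<in> subtrees (Node t1 a t2) \<longleftrightarrow>
     l = t1 \<and> v = a \<and> r = t2 \<or> Node l v r \<in> subtrees t1 \<or> Node l v r \<in> subtrees t2"
  by simp

text \<open>Distinct labels make vertices and nonempty subtrees correspond to each other, so that a statement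
  about the label \<open>v\<close> becomes one about the subtree rooted there.\<close>

lemma subtree_at_unique:
  assumes "distinct (inorder t)" "Node l v r \<in> subtrees t" "Node l' v r' \<in> subtrees t"
  shows "l' = l \<and> r' = r"
  using assms
proof (induction t)
  case (Node t1 a t2)
  have dist: "distinct (inorder t1)" "distinct (inorder t2)" using Node.prems(1) by auto
  have "v \<in> set_tree (Node t1 a t2)" using Node.prems(2) by (rule subtree_label_in)
  with Node.prems(1) consider
      "v = a" "v \<notin> set_tree t1" "v \<notin> set_tree t2"
    | "v \<noteq> a" "v \<in> set_tree t1" "v \<notin> set_tree t2"
    | "v \<noteq> a" "v \<notin> set_tree t1" "v \<in> set_tree t2"
    by auto
  then show ?case
  proof cases
    case 1
    then show ?thesis using Node.prems(2,3) in_subtrees_Node subtree_label_in by metis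
  next
    case 2
    then have "Node l v r \<in> subtrees t1" "Node l' v r' \<in> subtrees t1"
      using Node.prems(2,3) in_subtrees_Node subtree_label_in by metis+
    then show ?thesis by (rule Node.IH(1)[OF dist(1)])
  next
    case 3
    then have "Node l v r \<in> subtrees t2" "Node l' v r' \<in> subtrees t2"
      using Node.prems(2,3) in_subtrees_Node subtree_label_in by metis+
    then show ?thesis by (rule Node.IH(2)[OF dist(2)])
  qed
qed simp

lemma child_of_subtree_iff:
  assumes "distinct (inorder t)" "Node l v r \<in> subtrees t"
  shows "child_of t v w \<longleftrightarrow> (\<exists>l' r'. l = Node l' w r' \<or> r = Node l' w r')"
  unfolding child_of_def using subtree_at_unique[OF assms] assms(2) by metis

lemma leaf_vertex_subtree_iff:
  assumes "distinct (inorder t)" "Node l v r \<in> subtrees t"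
  shows "leaf_vertex t v \<longleftrightarrow> l = Leaf \<and> r = Leaf"
  unfolding leaf_vertex_def child_of_subtree_iff[OF assms]
  using subtree_label_in[OF assms(2)] by (metis tree.distinct(1) tree.exhaust)

lemma descending_leaf_path_Cons:
  "descending_leaf_path t v (u # p) \<longleftrightarrow>
     u = v \<and> (if p = [] then leaf_vertex t v
               else child_of t v (hd p) \<and> descending_leaf_path t (hd p) p)"
  unfolding descending_leaf_path_def by (cases p) auto

text \<open>Splitting off the first edge of a path. By itself the equation does not determine the path lengths, as
  nothing decreases from \<open>v\<close> to a child; the size of the subtree at \<open>v\<close> provides the induction.\<close>

lemma leaf_path_lengths_rec:
  "leaf_path_lengths t v =
     (if leaf_vertex t v then {0} else {}) \<union> Suc ` (\<Union>w \<in> {w. child_of t v w}. leaf_path_lengths t w)"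
  (is "?L = ?R")
proof (rule set_eqI)
  fix d
  have nonempty: "descending_leaf_path t w p \<Longrightarrow> p \<noteq> [] \<and> hd p = w" for w p
    by (simp add: descending_leaf_path_def)
  have L_iff: "d \<in> ?L \<longleftrightarrow> (\<exists>u p. descending_leaf_path t v (u # p) \<and> length p = d)"
    unfolding leaf_path_lengths_def mem_Collect_eq length_Suc_conv by blast
  show "d \<in> ?L \<longleftrightarrow> d \<in> ?R"
  proof (cases d)
    case 0
    then show ?thesis unfolding L_iff by (auto simp: descending_leaf_path_Cons)
  next
    case (Suc e)
    have "d \<in> ?L \<longleftrightarrow> (\<exists>u p. descending_leaf_path t v (u # p) \<and> length p = Suc e)"
      unfolding L_iff unfolding Suc ..
    also have "\<dots> \<longleftrightarrow> (\<exists>p. child_of t v (hd p) \<and> descending_leaf_path t (hd p) p \<and> length p = Suc e)"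
      by (metis descending_leaf_path_Cons list.size(3) nat.distinct(1))
    also have "\<dots> \<longleftrightarrow> (\<exists>w. child_of t v w \<and> e \<in> leaf_path_lengths t w)"
      unfolding leaf_path_lengths_def mem_Collect_eq using nonempty by metis
    also have "\<dots> \<longleftrightarrow> d \<in> ?R" by (simp add: Suc inj_image_mem_iff)
    finally show ?thesis .
  qed
qed

text \<open>The children of \<open>v\<close> in \<open>t\<close> are the roots of the two subtrees below \<open>v\<close>, so both sides satisfy the
  same recursion on the size of the subtree at \<open>v\<close>; the ambient tree \<open>t\<close> stays fixed.\<close>

lemma leaf_path_lengths_eq_leaf_depths:
  assumes "distinct (inorder t)" "Node l v r \<in> subtrees t"
  shows "leaf_path_lengths t v = leaf_depths (Node l v r)"
  using assms(2)
proof (induction "Node l v r" arbitrary: l v r rule: measure_induct_rule[where f = size])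
  case (less l v r)
  define root_labels where
    "root_labels = (\<lambda>s :: 'a tree. case s of Leaf \<Rightarrow> {} | Node _ w _ \<Rightarrow> {w})"
  have IH: "(\<Union>w \<in> root_labels s. leaf_path_lengths t w) = leaf_depths s"
    if s: "s = l \<or> s = r" for s
  proof (cases s)
    case (Node l' w r')
    have "s \<in> subtrees t" "size s < size (Node l v r)"
      using s subtrees_trans[OF less.prems] subtrees_refl by auto
    then have "leaf_path_lengths t w = leaf_depths s"
      unfolding Node by (intro less.hyps)
    then show ?thesis by (simp add: root_labels_def Node)
  qed (simp add: root_labels_def)
  have children: "{w. child_of t v w} = root_labels l \<union> root_labels r"
    unfolding child_of_subtree_iff[OF assms(1) less.prems] root_labels_def
    by (auto split: tree.splits)
  have "leaf_path_lengths t v =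
      (if l = Leaf \<and> r = Leaf then {0} else {}) \<union> Suc ` (leaf_depths l \<union> leaf_depths r)"
    unfolding leaf_path_lengths_rec[of t v] leaf_vertex_subtree_iff[OF assms(1) less.prems]
      children UN_Un IH[OF disjI1[OF refl]] IH[OF disjI2[OF refl]] ..
  also have "\<dots> = leaf_depths (Node l v r)"
    by (simp add: leaf_depths_Node)
  finally show ?case .
qed

text \<open>Balance asks for at most one path length. Since a nonempty tree has a leaf vertex, the set of
  lengths is then a singleton, and \<^const>\<open>rank\<close> picks its element.\<close>

lemma balanced_rank_iff:
  assumes "distinct (inorder t)" "Node l v r \<in> subtrees t"
  shows "balanced t v \<and> rank t v = k \<longleftrightarrow> leaf_depths (Node l v r) = {k}"
proof -
  have singleton: "X \<noteq> {} \<Longrightarrow> (\<forall>d\<in>X. \<forall>e\<in>X. d = e) \<and> the_elem X = k \<longleftrightarrow> X = {k}" for X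
    by (metis all_not_in_conv insertI1 singletonD subsetI subset_singletonD the_elem_eq)
  have "balanced t v \<and> rank t v = k \<longleftrightarrow> leaf_path_lengths t v = {k}"
    using singleton[of "leaf_path_lengths t v"] subtree_label_in[OF assms(2)]
      leaf_path_lengths_eq_leaf_depths[OF assms] leaf_depths_nonempty[of "Node l v r"]
    unfolding balanced_def rank_def by (metis tree.distinct(1))
  then show ?thesis
    by (simp only: leaf_path_lengths_eq_leaf_depths[OF assms])
qed

text \<open>The statistic summed in \<^const>\<open>balanced_count\<close>, as a recursion on the tree that never compares
  labels. This makes it additive over the two subtrees of the root and invariant under
  relabelling.\<close>

fun balanced_vertices :: "nat \<Rightarrow> 'a tree \<Rightarrow> nat" where
  "balanced_vertices k Leaf = 0"
| "balanced_vertices k (Node l a r) =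
     balanced_vertices k l + balanced_vertices k r +
     of_bool (leaf_depths (Node l a r) = {k})"

lemma card_balanced_vertices:
  assumes "distinct (inorder t)"
  shows "card {v \<in> set_tree t. balanced t v \<and> rank t v = k} = balanced_vertices k t"
proof -
  define B where "B = (\<lambda>s :: 'a tree. {v. \<exists>l r. Node l v r \<in> subtrees s \<and> leaf_depths (Node l v r) = {k}})"
  have B_sub: "B s \<subseteq> set_tree s" for s
    unfolding B_def by (auto dest: subtree_label_in)
  have "{v \<in> set_tree t. balanced t v \<and> rank t v = k} = B t"
    unfolding B_def
  proof (rule Collect_cong)
    fix v
    show "v \<in> set_tree t \<and> balanced t v \<and> rank t v = k \<longleftrightarrow>
        (\<exists>l r. Node l v r \<in> subtrees t \<and> leaf_depths (Node l v r) = {k})"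
      using balanced_rank_iff[OF assms] ex_subtree_iff[of v t] by metis
  qed
  moreover have "card (B s) = balanced_vertices k s" if "distinct (inorder s)" for s
    using that
  proof (induction s)
    case Leaf
    then show ?case by (simp add: B_def)
  next
    case (Node l a r)
    have fin: "finite (B l)" "finite (B r)"
      using B_sub finite_subset finite_set_tree by metis+
    have disj: "B l \<inter> B r = {}" "a \<notin> B l" "a \<notin> B r"
      using Node.prems B_sub[of l] B_sub[of r] by auto
    have "B (Node l a r) = (if leaf_depths (Node l a r) = {k} then insert a (B l \<union> B r) else B l \<union> B r)"
      unfolding B_def in_subtrees_Node by auto
    then show ?case
      using Node fin disj by (simp add: card_Un_disjoint)
  qed
  ultimately show ?thesis using assms by simp
qed

section \<open>Decreasing trees on an arbitrary label set\<close>

fun decreasing :: "'a::linorder tree \<Rightarrow> bool" where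
  "decreasing Leaf \<longleftrightarrow> True"
| "decreasing (Node l a r) \<longleftrightarrow>
     decreasing l \<and> decreasing r \<and> (\<forall>x \<in> set_tree l \<union> set_tree r. x < a)"

lemma child_of_Node:
  "child_of (Node l a r) u v \<longleftrightarrow>
     (u = a \<and> (\<exists>l' r'. l = Node l' v r' \<or> r = Node l' v r')) \<or> child_of l u v \<or> child_of r u v"
  unfolding child_of_def in_subtrees_Node by metis

text \<open>By transitivity it suffices to compare each vertex with its children.\<close>

lemma decreasing_iff_children: "decreasing t \<longleftrightarrow> (\<forall>u v. child_of t u v \<longrightarrow> v < u)"
proof (induction t)
  case Leaf
  then show ?case by (simp add: child_of_def)
next
  case (Node l a r)
  have root_max: "(\<forall>x\<in>set_tree s. x < a) \<longleftrightarrow> (\<forall>l' v r'. s = Node l' v r' \<longrightarrow> v < a)" if "decreasing s" for s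
    using that by (cases s) (auto intro: order.strict_trans)
  have "decreasing (Node l a r) \<longleftrightarrow> decreasing l \<and> decreasing r \<and>
      (\<forall>l' v r'. l = Node l' v r' \<longrightarrow> v < a) \<and> (\<forall>l' v r'. r = Node l' v r' \<longrightarrow> v < a)"
    unfolding decreasing.simps ball_Un using root_max[of l] root_max[of r] by argo
  also have "\<dots> \<longleftrightarrow> (\<forall>u v. child_of (Node l a r) u v \<longrightarrow> v < u)"
    unfolding Node.IH child_of_Node by (safe; blast)
  finally show ?case .
qed

definition trees_on :: "'a::linorder set \<Rightarrow> 'a tree set" where
  "trees_on S = {t. set_tree t = S \<and> distinct (inorder t) \<and> decreasing t}"

lemma decreasing_binary_trees_eq: "decreasing_binary_trees n = trees_on {1..n}"
  by (simp add: decreasing_binary_trees_def trees_on_def decreasing_iff_children)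

lemma trees_on_empty: "trees_on {} = {Leaf}"
  by (auto simp: trees_on_def)

text \<open>The decomposition at the root: the root of a decreasing tree has the largest label, and the
  remaining labels are distributed freely over the two sides.\<close>

lemma trees_on_insert:
  assumes "\<forall>x \<in> S. x < m"
  shows "bij_betw (\<lambda>(X, l, r). Node l m r)
           (SIGMA X:Pow S. trees_on X \<times> trees_on (S - X)) (trees_on (insert m S))"
proof (rule bij_betw_imageI)
  show "inj_on (\<lambda>(X, l, r). Node l m r) (SIGMA X:Pow S. trees_on X \<times> trees_on (S - X))"
    by (auto simp: inj_on_def trees_on_def)
  show "(\<lambda>(X, l, r). Node l m r) ` (SIGMA X:Pow S. trees_on X \<times> trees_on (S - X)) = trees_on (insert m S)"
    (is "?I = ?T")
  proof
    show "?I \<subseteq> ?T"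
    proof clarify
      fix X l r assume "X \<subseteq> S" "l \<in> trees_on X" "r \<in> trees_on (S - X)"
      then have l: "set_tree l = X" "distinct (inorder l)" "decreasing l"
        and r: "set_tree r = S - X" "distinct (inorder r)" "decreasing r"
        and un: "X \<union> (S - X) = S"
        by (auto simp: trees_on_def)
      have "m \<notin> S" using assms by blast
      then show "Node l m r \<in> ?T"
        using assms un by (auto simp: trees_on_def l r)
    qed
    show "?T \<subseteq> ?I"
    proof
      fix t assume t: "t \<in> ?T"
      then obtain l a r where t_eq: "t = Node l a r"
        by (cases t) (auto simp: trees_on_def)
      have disj: "set_tree l \<inter> set_tree r = {}"
        and lt: "\<forall>x \<in> set_tree l \<union> set_tree r. x < a"
        and un: "insert a (set_tree l \<union> set_tree r) = insert m S"
        using t by (auto simp: trees_on_def t_eq)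
      \<comment> \<open>Both \<open>a\<close> and \<open>m\<close> are the largest label.\<close>
      have a: "a = m"
      proof (rule ccontr)
        assume "a \<noteq> m"
        moreover have "a \<in> insert m S" "m \<in> insert a (set_tree l \<union> set_tree r)"
          using un by (metis insertI1)+
        ultimately have "a \<in> S" "m \<in> set_tree l \<union> set_tree r" by simp_all
        then show False using lt assms by (meson order_less_asym)
      qed
      have "a \<notin> set_tree l \<union> set_tree r" "m \<notin> S" using lt assms by blast+
      then have "set_tree l \<union> set_tree r = S" using un a by (metis insert_ident)
      then have "set_tree l \<subseteq> S" "set_tree r = S - set_tree l" using disj by auto
      then have "(set_tree l, l, r) \<in> (SIGMA X:Pow S. trees_on X \<times> trees_on (S - X))"
        using t by (auto simp: trees_on_def t_eq)
      then show "t \<in> ?I" by (rule rev_image_eqI) (simp add: a t_eq)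
    qed
  qed
qed

lemma finite_trees_on:
  assumes "finite S"
  shows "finite (trees_on S)"
proof (rule finite_subset)
  have "size t = card (set_tree t)" if "distinct (inorder t)" for t :: "'a tree"
    using distinct_card[OF that] by simp
  then show "trees_on S \<subseteq> {t. set_tree t \<subseteq> S \<and> size t \<le> card S}"
    by (auto simp: trees_on_def)
qed (rule finite_trees_of_size[OF assms])

lemma sum_trees_on_insert:
  fixes F :: "'a::linorder tree \<Rightarrow> nat"
  assumes "finite S" "\<forall>x \<in> S. x < m"
  shows "(\<Sum>t\<in>trees_on (insert m S). F t) =
         (\<Sum>X\<in>Pow S. \<Sum>l\<in>trees_on X. \<Sum>r\<in>trees_on (S - X). F (Node l m r))"
proof -
  have fin: "finite (trees_on X)" if "X \<subseteq> S" for X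
    using that assms(1) finite_subset finite_trees_on by blast
  have "(\<Sum>t\<in>trees_on (insert m S). F t) =
        (\<Sum>(X, l, r)\<in>(SIGMA X:Pow S. trees_on X \<times> trees_on (S - X)). F (Node l m r))"
    by (subst sum.reindex_bij_betw[OF trees_on_insert[OF assms(2)], symmetric])
      (auto intro!: sum.cong)
  also have "\<dots> = (\<Sum>X\<in>Pow S. \<Sum>(l, r)\<in>trees_on X \<times> trees_on (S - X). F (Node l m r))"
    using assms(1) fin by (subst sum.Sigma) (auto intro!: sum.cong)
  also have "\<dots> = (\<Sum>X\<in>Pow S. \<Sum>l\<in>trees_on X. \<Sum>r\<in>trees_on (S - X). F (Node l m r))"
    by (simp add: sum.cartesian_product)
  finally show ?thesis .
qed

lemma decreasing_map_tree:
  assumes "strict_mono_on (set_tree t) f" "decreasing t"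
  shows "decreasing (map_tree f t)"
  using assms
  by (induction t) (auto simp: strict_mono_on_def tree.set_map)

lemma map_tree_in_trees_on:
  assumes "strict_mono_on S f" "t \<in> trees_on S"
  shows "map_tree f t \<in> trees_on (f ` S)"
  using assms decreasing_map_tree[of t f] strict_mono_on_imp_inj_on[OF assms(1)]
  by (auto simp: trees_on_def tree.set_map inorder_map distinct_map)

text \<open>The inverse of an order-preserving map between linearly ordered sets preserves the order as well, so
  relabelling can be undone.\<close>

lemma bij_betw_relabel:
  assumes "strict_mono_on S f"
  shows "bij_betw (map_tree f) (trees_on S) (trees_on (f ` S))"
proof -
  have inj: "inj_on f S" by (rule strict_mono_on_imp_inj_on[OF assms])
  define g where "g = inv_into S f"
  have gf: "g (f x) = x" if "x \<in> S" for x using inj that by (simp add: g_def)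
  have "strict_mono_on (f ` S) g"
    using assms by (auto simp: strict_mono_on_def gf) (metis linorder_less_linear order_less_asym)
  moreover have "g ` f ` S = S" using gf by (auto simp: image_iff)
  ultimately have unrelabel: "map_tree g t \<in> trees_on S" if "t \<in> trees_on (f ` S)" for t
    using map_tree_in_trees_on that by metis
  show ?thesis
  proof (rule bij_betw_byWitness[where f' = "map_tree g"])
    show "\<forall>t\<in>trees_on S. map_tree g (map_tree f t) = t"
      by (auto simp: trees_on_def tree.map_comp gf intro!: tree.map_ident_strong)
    show "\<forall>t\<in>trees_on (f ` S). map_tree f (map_tree g t) = t"
      by (auto simp: trees_on_def tree.map_comp gf intro!: tree.map_ident_strong)
    show "map_tree f ` trees_on S \<subseteq> trees_on (f ` S)"
      using map_tree_in_trees_on[OF assms] by blast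
    show "map_tree g ` trees_on (f ` S) \<subseteq> trees_on S"
      using unrelabel by blast
  qed
qed

lemma leaf_depths_map_tree: "leaf_depths (map_tree f t) = leaf_depths t"
  by (induction t) (simp_all add: leaf_depths_Node)

lemma balanced_vertices_map_tree: "balanced_vertices k (map_tree f t) = balanced_vertices k t"
proof (induction t)
  case (Node l a r)
  then show ?case using leaf_depths_map_tree[of f "Node l a r"] by simp
qed simp

text \<open>Finite sets of the same size are order-isomorphic, so the sum of a statistic of the
  unlabelled shape depends only on the number of labels.\<close>

lemma sum_trees_on_cong_card:
  fixes F :: "nat tree \<Rightarrow> nat"
  assumes "finite S" "finite S'" "card S = card S'" "\<And>f t. F (map_tree f t) = F t"
  shows "(\<Sum>t\<in>trees_on S. F t) = (\<Sum>t\<in>trees_on S'. F t)"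
proof -
  have initial: "(\<Sum>t\<in>trees_on T. F t) = (\<Sum>t\<in>trees_on {..<card T}. F t)" if T: "finite T" for T
  proof -
    obtain h where h: "bij_betw h {..<card T} T" "strict_mono_on {..<card T} h"
      by (rule ex_bij_betw_strict_mono_card[OF T])
    have "bij_betw (map_tree h) (trees_on {..<card T}) (trees_on T)"
      using bij_betw_relabel[OF h(2)] h(1) by (simp add: bij_betw_imp_surj_on)
    from sum.reindex_bij_betw[OF this, of F] show ?thesis by (simp add: assms(4))
  qed
  show ?thesis using initial[OF assms(1)] initial[OF assms(2)] assms(3) by simp
qed

section \<open>Recurrences for the counts\<close>

lemma sum_Pow_card:
  fixes g :: "nat \<Rightarrow> nat"
  assumes "finite S"
  shows "(\<Sum>X\<in>Pow S. g (card X)) = (\<Sum>i\<le>card S. (card S choose i) * g i)"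
proof -
  have "(\<Sum>X\<in>Pow S. g (card X)) = (\<Sum>i\<le>card S. \<Sum>X\<in>{X \<in> Pow S. card X = i}. g (card X))"
    using assms by (intro sum.group[symmetric]) (auto intro: card_mono)
  also have "\<dots> = (\<Sum>i\<le>card S. (card S choose i) * g i)"
    using n_subsets[OF assms] by (intro sum.cong) auto
  finally show ?thesis .
qed

lemma trees_on_Suc: "trees_on {1..Suc n} = trees_on (insert (Suc n) {1..n})"
  by (simp add: atLeastAtMostSuc_conv)

text \<open>The root decomposition gives the sum of \<open>(n choose i) i! (n - i)!\<close> over \<open>i \<le> n\<close>
  for the trees on \<open>n + 1\<close> labels; each of its \<open>n + 1\<close> terms is \<open>n!\<close>.\<close>

lemma card_trees_on:
  fixes S :: "'a::linorder set"
  assumes "finite S"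
  shows "card (trees_on S) = fact (card S)"
  using assms
proof (induction S rule: finite_psubset_induct)
  case (psubset S)
  show ?case
  proof (cases "S = {}")
    case True
    then show ?thesis by (simp add: trees_on_empty)
  next
    case False
    define m U where "m = Max S" and "U = S - {m}"
    have U: "finite U" "\<forall>x\<in>U. x < m" and S: "S = insert m U" "m \<notin> U"
      using psubset.hyps Max_in[OF psubset.hyps False] by (auto simp: m_def U_def order.strict_iff_order)
    have IH: "card (trees_on X) = fact (card X)" if "X \<subseteq> U" for X
      using that S by (intro psubset.IH) auto
    have "card (trees_on S) = (\<Sum>t\<in>trees_on (insert m U). 1)"
      by (simp add: S)
    also have "\<dots> = (\<Sum>X\<in>Pow U. card (trees_on X) * card (trees_on (U - X)))"
      by (subst sum_trees_on_insert[OF U]) simp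
    also have "\<dots> = (\<Sum>X\<in>Pow U. fact (card X) * fact (card U - card X))"
      by (intro sum.cong refl)
        (use U(1) in \<open>simp add: IH card_Diff_subset finite_subset\<close>)
    also have "\<dots> = (\<Sum>i\<le>card U. (card U choose i) * (fact i * fact (card U - i)))"
      by (rule sum_Pow_card[OF U(1)])
    also have "\<dots> = (\<Sum>i\<le>card U. fact (card U))"
      by (intro sum.cong refl) (simp add: mult.commute[of "card U choose _"] binomial_fact_lemma)
    also have "\<dots> = fact (card S)"
      using S U(1) by simp
    finally show ?thesis .
  qed
qed

lemma balanced_count_eq: "balanced_count n k = (\<Sum>t\<in>trees_on {1..n}. balanced_vertices k t)"
  unfolding balanced_count_def decreasing_binary_trees_eq
  by (intro sum.cong refl card_balanced_vertices) (simp add: trees_on_def)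

lemma root_balanced_count_eq:
  "root_balanced_count n k = (\<Sum>t\<in>trees_on {1..n}. of_bool (leaf_depths t = {k}))"
proof -
  have "{t \<in> trees_on {1..n}. t \<noteq> Leaf \<and> balanced t (value t) \<and> rank t (value t) = k}
      = {t \<in> trees_on {1..n}. leaf_depths t = {k}}"
  proof (rule Collect_cong, rule conj_cong[OF refl])
    fix t assume "t \<in> trees_on {1..n}"
    then have "distinct (inorder t)" by (simp add: trees_on_def)
    then show "t \<noteq> Leaf \<and> balanced t (value t) \<and> rank t (value t) = k \<longleftrightarrow> leaf_depths t = {k}"
    proof (cases t)
      case (Node l v r)
      then show ?thesis
        using balanced_rank_iff[OF \<open>distinct (inorder t)\<close>, of l v r k] subtrees_refl[of t] by auto
    qed simp
  qed
  then show ?thesis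
    unfolding root_balanced_count_def decreasing_binary_trees_eq
    using finite_trees_on[of "{1..n}"] by (simp add: sum.If_cases of_bool_def Int_def)
qed

text \<open>The recurrence: the vertex counted lies in the left subtree, in the right subtree, or is the root
  itself.\<close>

lemma balanced_count_Suc:
  "balanced_count (Suc n) k =
     2 * (\<Sum>i\<le>n. (n choose i) * (balanced_count i k * fact (n - i))) + root_balanced_count (Suc n) k"
proof -
  let ?S = "{1..n}"
  let ?W = "\<lambda>X. \<Sum>t\<in>trees_on X. balanced_vertices k t"
  let ?C = "\<lambda>X. card (trees_on X)"
  have lt: "finite ?S" "\<forall>x\<in>?S. x < Suc n" by auto
  have W: "?W X = balanced_count (card X) k" and C: "?C (?S - X) = fact (n - card X)" if "X \<in> Pow ?S" for X
  proof -
    have fin: "finite X" using that finite_subset by blast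
    show "?W X = balanced_count (card X) k"
      using sum_trees_on_cong_card[OF fin, of "{1..card X}" "balanced_vertices k"]
      by (simp add: balanced_vertices_map_tree balanced_count_eq)
    show "?C (?S - X) = fact (n - card X)"
      using that fin by (simp add: card_trees_on card_Diff_subset)
  qed
  have split: "(\<Sum>l\<in>trees_on X. \<Sum>r\<in>trees_on (?S - X). balanced_vertices k (Node l (Suc n) r))
      = ?W X * ?C (?S - X) + ?W (?S - X) * ?C X
        + (\<Sum>l\<in>trees_on X. \<Sum>r\<in>trees_on (?S - X). of_bool (leaf_depths (Node l (Suc n) r) = {k}))" for X
    by (simp add: sum.distrib sum_distrib_left sum_distrib_right mult.commute)
  have "balanced_count (Suc n) k = (\<Sum>X\<in>Pow ?S. ?W X * ?C (?S - X)) + (\<Sum>X\<in>Pow ?S. ?W (?S - X) * ?C X)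
      + root_balanced_count (Suc n) k"
    unfolding balanced_count_eq root_balanced_count_eq trees_on_Suc
      sum_trees_on_insert[OF lt] split sum.distrib ..
  \<comment> \<open>Complementation exchanges the roles of the left and the right subtree.\<close>
  also have "(\<Sum>X\<in>Pow ?S. ?W (?S - X) * ?C X) = (\<Sum>X\<in>Pow ?S. ?W X * ?C (?S - X))"
    by (rule sum.reindex_bij_witness[where i = "\<lambda>X. ?S - X" and j = "\<lambda>X. ?S - X"])
      (auto simp: double_diff)
  also have "(\<Sum>X\<in>Pow ?S. ?W X * ?C (?S - X)) = (\<Sum>X\<in>Pow ?S. balanced_count (card X) k * fact (n - card X))"
    by (intro sum.cong refl) (simp only: W C)
  also have "\<dots> = (\<Sum>i\<le>n. (n choose i) * (balanced_count i k * fact (n - i)))"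
    by (subst sum_Pow_card) auto
  finally show ?thesis by simp
qed

section \<open>The differential equation\<close>

lemma fps_nth_divide_one_minus_X:
  fixes A :: "'a::field fps"
  shows "fps_nth (A / (1 - fps_X)) n = (\<Sum>i\<le>n. fps_nth A i)"
proof -
  have "A / (1 - fps_X) = A * Abs_fps (\<lambda>_. 1)"
    by (simp add: fps_divide_unit fps_inverse_one_minus_fps_X)
  then show ?thesis by (simp add: fps_mult_nth atLeast0AtMost)
qed

theorem proposition1p1:
  fixes k :: nat
  shows "fps_deriv (A_egf k) = 2 * (A_egf k / (1 - fps_X)) + fps_deriv (R_egf k) \<and> fps_nth (A_egf k) 0 = 0"
proof
  show "fps_nth (A_egf k) 0 = 0"
    by (simp add: A_egf_def balanced_count_eq trees_on_empty)
  show "fps_deriv (A_egf k) = 2 * (A_egf k / (1 - fps_X)) + fps_deriv (R_egf k)"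
  proof (rule fps_ext)
    fix n
    have deriv_nth: "of_nat (Suc n) * (of_nat c / fact (Suc n)) = (of_nat c / fact n :: rat)" for c
      by (simp add: divide_simps del: of_nat_Suc)
    have "of_nat ((n choose i) * (a * fact (n - i))) / fact n = (of_nat a / fact i :: rat)"
      if "i \<le> n" for i a
      using that by (simp add: binomial_fact divide_simps)
    then have conv: "of_nat (\<Sum>i\<le>n. (n choose i) * (balanced_count i k * fact (n - i))) / fact n
        = (\<Sum>i\<le>n. of_nat (balanced_count i k) / fact i :: rat)"
      unfolding of_nat_sum sum_divide_distrib by (intro sum.cong) auto
    have "fps_nth (fps_deriv (A_egf k)) n = (of_nat (balanced_count (Suc n) k) / fact n :: rat)"
      using deriv_nth by (simp add: A_egf_def)
    also have "\<dots> = 2 * (\<Sum>i\<le>n. of_nat (balanced_count i k) / fact i)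
        + of_nat (root_balanced_count (Suc n) k) / fact n"
      unfolding conv[symmetric] balanced_count_Suc by (simp add: add_divide_distrib)
    also have "\<dots> = fps_nth (2 * (A_egf k / (1 - fps_X)) + fps_deriv (R_egf k)) n"
      using deriv_nth
      by (simp add: A_egf_def R_egf_def fps_nth_divide_one_minus_X numeral_fps_const)
    finally show "fps_nth (fps_deriv (A_egf k)) n
        = fps_nth (2 * (A_egf k / (1 - fps_X)) + fps_deriv (R_egf k)) n" .
  qed
qed

end
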